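(* Suppose a randomized algorithm knows the number $n$ of vertices of an unknown graph $G=(V,E)$. Suppose it has access to the $\mathbf{RandVert}$, $\mathbf{RandNbr}$, $\mathbf{Degree}$ and $\mathbf{RandEdge}$ oracles, and with probability $>2/3$ returns an $O(1)$-approximation to $d$. Then: (a) if it has no other oracle access, the algorithm must make $\Omega(n^{1/3})$ queries; (b) if it additionally has access to the $\mathbf{Pair}$ oracle, the algorithm must make $\Omega(n^{1/4})$ queries; (c) if it additionally has access to the $\mathbf{FullNbrHood}$ oracle, the algorithm must make $\Omega(n^{1/5})$ queries.
   Context: $G$ is a simple undirected graph with $n$ vertices and $m$ edges, and $d=2m/n$ is its average degree. The oracles, each of unit cost, are: - $\mathbf{RandVert}()$ returns a uniformly random vertex. - $\mathbf{RandNbr}(x)$ returns a uniformly random neighbor of $x$. - $\mathbf{Degree}(x)$ returns $\deg(x)$. - $\mathbf{RandEdge}()$ returns a uniformly random edge. - $\mathbf{Pair}(x,y)$ returns whether $\{x,y\}\in E$. - $\mathbf{FullNbrHood}(x)$ returns the full adjacency list of $x$. An $O(1)$-approximation to $d$ is a value in $[d/c,cd]$ for some constant $c\ge 1$. *)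

theory Defs
  imports "HOL-Probability.Probability" "HOL-Library.Landau_Symbols"
begin

type_synonym vertex = nat

text \<open>
  A simple undirected graph with \<open>n\<close> vertices has vertex set \<open>{..<n}\<close> and is given by its
  set of edges, an edge being the unordered pair of its two distinct endpoints.
\<close>

definition simple_graph :: "nat \<Rightarrow> vertex set set \<Rightarrow> bool" where
  "simple_graph n E \<longleftrightarrow> (\<forall>e\<in>E. e \<subseteq> {..<n} \<and> card e = 2)"

definition nbrs :: "vertex set set \<Rightarrow> vertex \<Rightarrow> vertex set" where
  "nbrs E x = {y. {x, y} \<in> E}"

definition avg_degree :: "nat \<Rightarrow> vertex set set \<Rightarrow> real" where
  "avg_degree n E = 2 * real (card E) / real n"

datatype query =
    RandVert
  | RandNbr vertex
  | Degree vertex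
  | RandEdge
  | Pair vertex vertex
  | FullNbrHood vertex

datatype answer =
    AVertex vertex
  | ADegree nat
  | AEdge "vertex set"
  | AAdjacent bool
  | ANbrs "vertex set"
  | ANone

text \<open>
  \<open>ANone\<close> answers a request for a random neighbor of an isolated vertex, or for a random edge
  of a graph without edges. A number that is not a vertex is treated like an isolated vertex.
  An adjacency list is returned as the set of neighbors, so its order carries no information.
\<close>

fun reply :: "nat \<Rightarrow> vertex set set \<Rightarrow> query \<Rightarrow> answer pmf" where
  "reply n E RandVert = map_pmf AVertex (pmf_of_set {..<n})"
| "reply n E (RandNbr x) =
     (if nbrs E x = {} then return_pmf ANone else map_pmf AVertex (pmf_of_set (nbrs E x)))"
| "reply n E (Degree x) = return_pmf (ADegree (card (nbrs E x)))"
| "reply n E RandEdge =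
     (if E = {} then return_pmf ANone else map_pmf AEdge (pmf_of_set E))"
| "reply n E (Pair x y) = return_pmf (AAdjacent ({x, y} \<in> E))"
| "reply n E (FullNbrHood x) = return_pmf (ANbrs (nbrs E x))"

text \<open>
  An adaptive randomized algorithm, for a fixed number of vertices, is a decision tree:
  it outputs a number, or asks a query and continues depending on the answer, or uses internal
  randomness to choose how to continue. Trees are well-founded but may be infinitely branching.
\<close>

datatype algorithm =
    Output real
  | Ask query "answer \<Rightarrow> algorithm"
  | Choose "algorithm pmf"

text \<open>Joint distribution of the output and the number of queries made.\<close>

primrec run :: "nat \<Rightarrow> vertex set set \<Rightarrow> algorithm \<Rightarrow> (real \<times> nat) pmf" where
  "run n E (Output r) = return_pmf (r, 0)"
| "run n E (Ask q k) =
     bind_pmf (reply n E q) (\<lambda>a. map_pmf (\<lambda>(r, t). (r, Suc t)) (run n E (k a)))"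
| "run n E (Choose p) = join_pmf (map_pmf (run n E) p)"

primrec queries :: "algorithm \<Rightarrow> query set" where
  "queries (Output r) = {}"
| "queries (Ask q k) = insert q (\<Union>a. queries (k a))"
| "queries (Choose p) = \<Union> (set_pmf (map_pmf queries p))"

text \<open>
  Below an algorithm that knows the number \<open>n\<close> of vertices is a family \<open>A\<close>,
  where \<open>A n\<close> is run on graphs with \<open>n\<close> vertices.
\<close>

definition has_access :: "query set \<Rightarrow> (nat \<Rightarrow> algorithm) \<Rightarrow> bool" where
  "has_access Q A \<longleftrightarrow> (\<forall>n\<ge>1. queries (A n) \<subseteq> Q)"

definition approximates_avg_degree :: "real \<Rightarrow> (nat \<Rightarrow> algorithm) \<Rightarrow> bool" where
  "approximates_avg_degree c A \<longleftrightarrow>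
     (\<forall>n\<ge>1. \<forall>E. simple_graph n E \<longrightarrow>
        measure_pmf.prob (run n E (A n))
          {(r, t). r \<in> {avg_degree n E / c .. c * avg_degree n E}} > 2 / 3)"

text \<open>\<open>q n\<close> bounds the number of queries in the worst case over graphs and random choices.\<close>

definition query_bound :: "(nat \<Rightarrow> algorithm) \<Rightarrow> (nat \<Rightarrow> nat) \<Rightarrow> bool" where
  "query_bound A q \<longleftrightarrow>
     (\<forall>n\<ge>1. \<forall>E. simple_graph n E \<longrightarrow> (\<forall>(r, t)\<in>set_pmf (run n E (A n)). t \<le> q n))"

definition basic_queries :: "query set" where
  "basic_queries = {RandVert, RandEdge} \<union> range RandNbr \<union> range Degree"

definition pair_queries :: "query set" where
  "pair_queries = {Pair x y | x y. True}"

definition full_nbr_hood_queries :: "query set" where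
  "full_nbr_hood_queries = range FullNbrHood"

end

theory Submission imports Defs begin

text \<open>
  One hard instance settles all three parts: a uniformly random matching with \<open>k\<close> edges, where
  \<open>k\<close> is about \<open>n\<^sup>2\<^sup>/\<^sup>3\<close>, against one with \<open>C * k\<close> edges, where \<open>C > c\<^sup>2\<close>. Given the answers so far, the
  unseen edges form a uniformly random matching of the unexplored vertices. Hence \<open>b\<close> queries hit a
  nonisolated unexplored vertex with probability \<open>O(b * k / n)\<close>, and sample a known edge
  with probability \<open>O(b\<^sup>2 / k)\<close>. Unless one of these happens, the answers do not depend on \<open>k\<close>, even
  for \<open>Pair\<close> and \<open>FullNbrHood\<close> queries, so \<open>b\<close> is at least of order \<open>n\<^sup>1\<^sup>/\<^sup>3\<close>.
\<close>

section \<open>Counting matchings\<close>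

definition vertex_pairs :: "'a set \<Rightarrow> 'a set set" where
  "vertex_pairs U = {e. e \<subseteq> U \<and> card e = 2}"

definition matchings :: "'a set \<Rightarrow> nat \<Rightarrow> 'a set set set" where
  "matchings U j = {M. M \<subseteq> vertex_pairs U \<and> pairwise disjnt M \<and> card M = j}"

lemma finite_vertex_pairs: "finite U \<Longrightarrow> finite (vertex_pairs U)"
  by (rule finite_subset[of _ "Pow U"]) (auto simp: vertex_pairs_def)

lemma card_vertex_pairs: "finite U \<Longrightarrow> card (vertex_pairs U) = card U choose 2"
  unfolding vertex_pairs_def by (rule n_subsets)

lemma finite_matchings: "finite U \<Longrightarrow> finite (matchings U j)"
  by (rule finite_subset[of _ "Pow (vertex_pairs U)"])
    (auto simp: matchings_def finite_vertex_pairs)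

lemma finite_matching: "finite U \<Longrightarrow> M \<in> matchings U j \<Longrightarrow> finite M"
  by (auto simp: matchings_def intro: finite_subset[OF _ finite_vertex_pairs])

lemma matchings_0: "finite U \<Longrightarrow> matchings U 0 = {{}}"
  by (auto simp: matchings_def dest: finite_subset[OF _ finite_vertex_pairs])

lemma Union_matching_subset: "M \<in> matchings U j \<Longrightarrow> \<Union>M \<subseteq> U"
  by (auto simp: matchings_def vertex_pairs_def)

lemma vertex_pair_nonempty: "e \<in> vertex_pairs U \<Longrightarrow> e \<noteq> {}"
  by (auto simp: vertex_pairs_def)

text \<open>The edges of \<open>M\<close> avoid \<open>e\<close>, and \<open>e\<close> is nonempty,
  so none of them equals \<open>e\<close>.\<close>

lemma fresh_edge: "M \<in> matchings (U - e) j \<Longrightarrow> e \<in> vertex_pairs V \<Longrightarrow> e \<notin> M"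
  using Union_matching_subset[of M "U - e" j] vertex_pair_nonempty[of e V] by blast

section \<open>Adding and removing an edge of a matching\<close>

lemma insert_matching:
  assumes "finite U" "e \<in> vertex_pairs U" "M \<in> matchings (U - e) j"
  shows "insert e M \<in> matchings U (Suc j)"
proof -
  have "finite M" using assms finite_matching by blast
  moreover have "e \<notin> M" using fresh_edge assms by blast
  moreover have "pairwise disjnt (insert e M)"
    using assms Union_matching_subset[OF assms(3)]
    by (auto simp: matchings_def pairwise_insert disjnt_def)
  moreover have "M \<subseteq> vertex_pairs U"
    using assms by (auto simp: matchings_def vertex_pairs_def)
  ultimately show ?thesis using assms by (auto simp: matchings_def)
qed

lemma remove_matching:
  assumes "finite U" "M \<in> matchings U (Suc j)" "e \<in> M"
  shows "M - {e} \<in> matchings (U - e) j"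
proof -
  have "M - {e} \<subseteq> vertex_pairs (U - e)"
  proof
    fix f assume f: "f \<in> M - {e}"
    then have "disjnt f e" using assms by (auto simp: matchings_def pairwise_def)
    then show "f \<in> vertex_pairs (U - e)"
      using f assms by (auto simp: matchings_def vertex_pairs_def disjnt_def)
  qed
  moreover have "card (M - {e}) = j"
    using assms by (auto simp: matchings_def)
  moreover have "pairwise disjnt (M - {e})"
    using assms by (auto simp: matchings_def pairwise_def)
  ultimately show ?thesis by (auto simp: matchings_def)
qed

text \<open>Double counting of matchings with a marked edge: removing the marked edge and putting it
  back are inverse to each other. Together with \<open>card_matchings_remove_pair\<close> this says
  that a random edge of a random matching is a uniformly random pair, the other edges being a random
  matching of the remaining vertices.\<close>

lemma sum_matchings_edges:
  fixes g :: "'a set \<Rightarrow> 'a set set \<Rightarrow> 'b::comm_monoid_add"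
  assumes "finite U"
  shows "(\<Sum>M\<in>matchings U (Suc j). \<Sum>e\<in>M. g e M) =
         (\<Sum>e\<in>vertex_pairs U. \<Sum>M\<in>matchings (U - e) j. g e (insert e M))"
proof -
  have "(\<Sum>M\<in>matchings U (Suc j). \<Sum>e\<in>M. g e M) =
        (\<Sum>(M, e)\<in>(SIGMA M:matchings U (Suc j). M). g e M)"
    using assms by (intro sum.Sigma) (auto simp: finite_matchings finite_matching)
  also have "\<dots> = (\<Sum>(e, M)\<in>(SIGMA e:vertex_pairs U. matchings (U - e) j). g e (insert e M))"
    by (rule sum.reindex_bij_witness[where i="\<lambda>(e, M). (insert e M, e)"
          and j="\<lambda>(M, e). (e, M - {e})"])
      (auto simp: insert_absorb remove_matching insert_matching assms dest: fresh_edge,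
        auto simp: matchings_def)
  also have "\<dots> = (\<Sum>e\<in>vertex_pairs U. \<Sum>M\<in>matchings (U - e) j. g e (insert e M))"
    using assms by (intro sum.Sigma[symmetric]) (auto simp: finite_matchings finite_vertex_pairs)
  finally show ?thesis .
qed

section \<open>Invariance under relabelling the vertices\<close>

text \<open>A bijection of the vertices, lifted to edges and then to edge sets, maps matchings
  injectively to matchings. Exchanging \<open>U\<close> and \<open>V\<close> then gives
  equality.\<close>

lemma card_matchings_le:
  assumes "finite U" "finite V" "card U = card V"
  shows "card (matchings U j) \<le> card (matchings V j)"
proof -
  obtain f where f: "bij_betw f U V"
    using assms finite_same_card_bij by blast
  then have inj: "inj_on f U" and im: "f ` U = V" by (auto simp: bij_betw_def)
  have injP: "inj_on ((`) f) (Pow U)" using inj by (rule inj_on_image_Pow)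
  have sub: "vertex_pairs U \<subseteq> Pow U" by (auto simp: vertex_pairs_def)
  show ?thesis
  proof (rule card_inj_on_le)
    show "inj_on ((`) ((`) f)) (matchings U j)"
      by (rule inj_on_subset[OF inj_on_image_Pow[OF injP]]) (use sub in \<open>auto simp: matchings_def\<close>)
    show "(`) ((`) f) ` matchings U j \<subseteq> matchings V j"
    proof clarify
      fix M assume M: "M \<in> matchings U j"
      then have MP: "M \<subseteq> Pow U" using sub by (auto simp: matchings_def)
      have "(`) f ` M \<subseteq> vertex_pairs V"
      proof clarify
        fix e assume "e \<in> M"
        then have "e \<subseteq> U" "card e = 2" using M by (auto simp: matchings_def vertex_pairs_def)
        then show "f ` e \<in> vertex_pairs V"
          using im inj_on_subset[OF inj \<open>e \<subseteq> U\<close>] by (auto simp: vertex_pairs_def card_image)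
      qed
      moreover have "card ((`) f ` M) = j"
        using M inj_on_subset[OF injP MP] by (simp add: card_image matchings_def)
      moreover have "pairwise disjnt ((`) f ` M)"
      proof (rule pairwise_imageI)
        fix x y assume xy: "x \<in> M" "y \<in> M" "x \<noteq> y"
        then have "x \<inter> y = {}" using M by (auto simp: matchings_def pairwise_def disjnt_def)
        moreover have "x \<subseteq> U" "y \<subseteq> U" using xy MP by auto
        ultimately show "disjnt (f ` x) (f ` y)"
          using inj_on_image_Int[OF inj, of x y] by (auto simp: disjnt_def)
      qed
      ultimately show "(`) f ` M \<in> matchings V j" by (auto simp: matchings_def)
    qed
  qed (use assms in \<open>simp add: finite_matchings\<close>)
qed

lemma card_matchings_cong:
  assumes "finite U" "finite V" "card U = card V"
  shows "card (matchings U j) = card (matchings V j)"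
  using card_matchings_le[of U V j] card_matchings_le[of V U j] assms by simp

lemma card_matchings_remove_pair:
  assumes "finite U" "e \<in> vertex_pairs U" "e' \<in> vertex_pairs U"
  shows "card (matchings (U - e) j) = card (matchings (U - e') j)"
  using assms by (intro card_matchings_cong)
    (auto simp: vertex_pairs_def card_Diff_subset finite_subset)

text \<open>Both sides count matchings with a marked edge; the number of ways to complete a marked
  edge is the same for all pairs.\<close>

lemma card_matchings_Suc:
  assumes "finite U" "e \<in> vertex_pairs U"
  shows "Suc j * card (matchings U (Suc j)) = (card U choose 2) * card (matchings (U - e) j)"
proof -
  have "Suc j * card (matchings U (Suc j)) = (\<Sum>M\<in>matchings U (Suc j). \<Sum>f\<in>M. 1)"
    by (simp add: matchings_def)
  also have "\<dots> = (\<Sum>f\<in>vertex_pairs U. card (matchings (U - f) j))"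
    by (simp only: sum_matchings_edges[OF assms(1)]) simp
  also have "\<dots> = (\<Sum>f\<in>vertex_pairs U. card (matchings (U - e) j))"
    using assms by (intro sum.cong card_matchings_remove_pair) auto
  finally show ?thesis using assms by (simp add: card_vertex_pairs)
qed

section \<open>How likely a random matching meets given vertices\<close>

lemma card_pairs_containing:
  assumes "finite U" "x \<in> U"
  shows "card {e \<in> vertex_pairs U. x \<in> e} \<le> card U - 1"
proof -
  have "{e \<in> vertex_pairs U. x \<in> e} \<subseteq> (\<lambda>y. {x, y}) ` (U - {x})"
    by (auto simp: vertex_pairs_def card_2_iff)
  then have "card {e \<in> vertex_pairs U. x \<in> e} \<le> card (U - {x})"
    using assms by (intro surj_card_le) auto
  then show ?thesis using assms by simp
qed

text \<open>A marked edge through \<open>x\<close> can be chosen in at most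
  \<open>card U - 1\<close> ways, each completed in equally many ways, and
  \<open>card_matchings_Suc\<close> relates this to all matchings. So a random matching covers
  \<open>x\<close> with probability at most \<open>2 * j / card U\<close>.\<close>

lemma card_matchings_covering:
  assumes "finite U" "x \<in> U"
  shows "card U * card {M \<in> matchings U j. x \<in> \<Union>M} \<le> 2 * j * card (matchings U j)"
proof (cases j)
  case 0
  then show ?thesis using assms by (auto simp: matchings_0)
next
  case (Suc i)
  show ?thesis
  proof (cases "vertex_pairs U = {}")
    case True
    then have "{M \<in> matchings U j. x \<in> \<Union>M} = {}" by (auto simp: matchings_def)
    then show ?thesis by (simp only: card.empty mult_0_right zero_le)
  next
    case False
    then obtain e where e: "e \<in> vertex_pairs U" by auto
    let ?c = "card (matchings (U - e) i)"
    have "card {M \<in> matchings U j. x \<in> \<Union>M} =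
          (\<Sum>M\<in>matchings U j. if x \<in> \<Union>M then 1 else 0)"
      using assms by (simp add: finite_matchings flip: sum.inter_filter)
    \<comment> \<open>A matching that covers \<open>x\<close> has at least one edge through
      \<open>x\<close>, so matchings may be replaced by marked edges.\<close>
    also have "\<dots> \<le> (\<Sum>M\<in>matchings U j. \<Sum>f\<in>M. if x \<in> f then 1 else 0)"
    proof (rule sum_mono)
      fix M assume M: "M \<in> matchings U j"
      then have fin: "finite M" using assms finite_matching by blast
      show "(if x \<in> \<Union>M then 1 else 0) \<le> (\<Sum>f\<in>M. if x \<in> f then 1 else (0::nat))"
      proof (cases "x \<in> \<Union>M")
        case True
        then obtain f where "f \<in> M" "x \<in> f" by auto
        then have "(if x \<in> f then 1 else 0) \<le> (\<Sum>f\<in>M. if x \<in> f then 1 else (0::nat))"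
          using fin by (intro member_le_sum) auto
        then show ?thesis using \<open>x \<in> f\<close> by simp
      qed simp
    qed
    also have "\<dots> = (\<Sum>f\<in>vertex_pairs U. \<Sum>M\<in>matchings (U - f) i. if x \<in> f then 1 else 0)"
      unfolding Suc by (rule sum_matchings_edges[OF assms(1)])
    also have "\<dots> = (\<Sum>f\<in>vertex_pairs U. if x \<in> f then ?c else 0)"
      using card_matchings_remove_pair[OF assms(1) e, of _ i] by (intro sum.cong) auto
    also have "\<dots> = card {f \<in> vertex_pairs U. x \<in> f} * ?c"
      using assms by (simp add: finite_vertex_pairs flip: sum.inter_filter)
    also have "\<dots> \<le> (card U - 1) * ?c"
      using card_pairs_containing[OF assms] by (intro mult_right_mono) auto
    finally have "card U * card {M \<in> matchings U j. x \<in> \<Union>M} \<le> card U * ((card U - 1) * ?c)"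
      by (rule mult_left_mono) simp
    also have "\<dots> = 2 * ((card U choose 2) * ?c)"
      using times_binomial_minus1_eq[of 2 "card U"] by simp
    also have "\<dots> = 2 * j * card (matchings U j)"
      using card_matchings_Suc[OF assms(1) e, of i] by (simp add: Suc)
    finally show ?thesis .
  qed
qed

text \<open>A union bound over \<open>D\<close>, which will be the set of unexplored vertices named
  in one query.\<close>

lemma card_matchings_touching:
  assumes "finite U" "D \<subseteq> U"
  shows "card U * card {M \<in> matchings U j. \<Union>M \<inter> D \<noteq> {}} \<le> 2 * j * card D * card (matchings U j)"
proof -
  have "finite D" using assms finite_subset by auto
  have "{M \<in> matchings U j. \<Union>M \<inter> D \<noteq> {}} = (\<Union>x\<in>D. {M \<in> matchings U j. x \<in> \<Union>M})"
    by auto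
  then have "card U * card {M \<in> matchings U j. \<Union>M \<inter> D \<noteq> {}}
      \<le> card U * (\<Sum>x\<in>D. card {M \<in> matchings U j. x \<in> \<Union>M})"
    using \<open>finite D\<close> by (simp add: card_UN_le)
  also have "\<dots> \<le> (\<Sum>x\<in>D. 2 * j * card (matchings U j))"
    unfolding sum_distrib_left using assms by (intro sum_mono card_matchings_covering) auto
  finally show ?thesis by (simp add: algebra_simps)
qed

text \<open>Edges are chosen one by one, each using up two vertices. This permits division by the
  number of matchings when averaging.\<close>

lemma matchings_nonempty:
  assumes "finite U" "2 * j \<le> card U"
  shows "matchings U j \<noteq> {}"
  using assms
proof (induction j arbitrary: U)
  case 0
  then show ?case by (simp add: matchings_0)
next
  case (Suc j)
  have "2 \<le> card U" using Suc.prems(2) by simp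
  then obtain e where "e \<subseteq> U" "card e = 2"
    by (rule obtain_subset_with_card_n)
  then have e: "e \<in> vertex_pairs U" by (simp add: vertex_pairs_def)
  have "card (U - e) = card U - 2"
    using \<open>e \<subseteq> U\<close> \<open>card e = 2\<close> Suc.prems(1) by (simp add: card_Diff_subset finite_subset)
  then have "matchings (U - e) j \<noteq> {}" using Suc.prems by (intro Suc.IH) auto
  then show ?case using insert_matching[OF Suc.prems(1) e] by blast
qed

section \<open>The ideal run\<close>

text \<open>Only through these vertices can hidden edges influence the reply to a query other than
  \<open>RandEdge\<close>.\<close>

definition arguments :: "query \<Rightarrow> vertex set" where
  "arguments z = (case z of RandNbr x \<Rightarrow> {x} | Degree x \<Rightarrow> {x} | Pair x y \<Rightarrow> {x, y}
     | FullNbrHood x \<Rightarrow> {x} | _ \<Rightarrow> {})"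

lemma card_arguments: "finite (arguments z)" "card (arguments z) \<le> 2"
  by (auto simp: arguments_def card_insert_if split: query.split)

definition tick :: "real \<times> nat \<Rightarrow> real \<times> nat" where
  "tick = (\<lambda>(r, t). (r, Suc t))"

text \<open>
  The state consists of the set \<open>U\<close> of unexplored vertices and the set \<open>F\<close> of the edges seen so far.
  Every sampled edge is new and unexplored, and every unexplored vertex that occurs in a query
  turns out to be isolated; the number of hidden edges plays no role.
\<close>

primrec ideal_run ::
    "nat \<Rightarrow> algorithm \<Rightarrow> vertex set \<Rightarrow> vertex set set \<Rightarrow> (real \<times> nat) pmf" where
  "ideal_run n (Output r) = (\<lambda>U F. return_pmf (r, 0))"
| "ideal_run n (Ask z k) = (\<lambda>U F. map_pmf tick
     (if z = RandEdge
      then bind_pmf (pmf_of_set (vertex_pairs U))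
             (\<lambda>e. ideal_run n (k (AEdge e)) (U - e) (insert e F))
      else bind_pmf (reply n F z) (\<lambda>a. ideal_run n (k a) (U - arguments z) F)))"
| "ideal_run n (Choose p) =
     (\<lambda>U F. join_pmf (map_pmf (\<lambda>h. h U F) (map_pmf (ideal_run n) p)))"

text \<open>At a vertex not covered by \<open>M\<close>, all adjacencies come from \<open>F\<close>.
  This settles \<open>Pair\<close> and \<open>FullNbrHood\<close> in the same way as
  \<open>Degree\<close> and \<open>RandNbr\<close>.\<close>

lemma reply_unexplored:
  assumes "z \<noteq> RandEdge" "\<Union>M \<inter> arguments z = {}"
  shows "reply n (F \<union> M) z = reply n F z"
proof -
  have "nbrs (F \<union> M) x = nbrs F x" if "x \<in> arguments z" for x
    using assms(2) that by (auto simp: nbrs_def)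
  moreover have "{x, y} \<notin> M" if "x \<in> arguments z" for x y
    using assms(2) that by auto
  ultimately show ?thesis using assms(1) by (cases z) (auto simp: arguments_def)
qed

lemma run_Ask: "run n E (Ask z k) = map_pmf tick (bind_pmf (reply n E z) (\<lambda>a. run n E (k a)))"
  by (simp add: tick_def map_bind_pmf)

lemma run_Choose: "run n E (Choose p) = bind_pmf p (run n E)"
  by (simp add: join_pmf_def bind_map_pmf)

lemma ideal_run_Choose: "ideal_run n (Choose p) U F = bind_pmf p (\<lambda>T. ideal_run n T U F)"
  by (simp add: join_pmf_def bind_map_pmf)

section \<open>Probabilities of events in composed runs\<close>

lemma prob_bind_pmf:
  "measure_pmf.prob (bind_pmf p f) X = measure_pmf.expectation p (\<lambda>x. measure_pmf.prob (f x) X)"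
proof -
  have "emeasure (bind_pmf p f) X = (\<integral>\<^sup>+x. ennreal (measure_pmf.prob (f x) X) \<partial>p)"
    unfolding emeasure_bind_pmf by (simp add: measure_pmf.emeasure_eq_measure)
  also have "\<dots> = ennreal (measure_pmf.expectation p (\<lambda>x. measure_pmf.prob (f x) X))"
    by (rule nn_integral_eq_integral)
      (auto intro!: measure_pmf.integrable_const_bound[where B=1])
  finally show ?thesis
    by (simp add: measure_pmf.emeasure_eq_measure integral_nonneg_AE)
qed

lemma prob_tick_0: "measure_pmf.prob (map_pmf tick p) (R \<times> {..0}) = 0"
proof -
  have "tick -` (R \<times> {..0}) = {}" by (auto simp: tick_def)
  then show ?thesis by simp
qed

text \<open>With the query count made part of the event, \<open>b\<close> acts as a budget that
  every query lowers by one, which suits induction on the decision tree.\<close>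

lemma prob_tick_Suc:
  "measure_pmf.prob (map_pmf tick p) (R \<times> {..Suc b}) = measure_pmf.prob p (R \<times> {..b})"
proof -
  have "tick -` (R \<times> {..Suc b}) = R \<times> {..b}" by (auto simp: tick_def)
  then show ?thesis by simp
qed

text \<open>Linearity and monotonicity of expectation. The first stage \<open>p\<close> is common to
  all \<open>i\<close>: it will be an internal random choice, or a reply that does not depend on the
  hidden matching.\<close>

lemma sum_prob_bind_le:
  fixes f :: "'i \<Rightarrow> 'a \<Rightarrow> 'b pmf" and c d :: real
  assumes "\<And>x. x \<in> set_pmf p \<Longrightarrow>
    (\<Sum>i\<in>I. measure_pmf.prob (f i x) X) \<le> c * (measure_pmf.prob (g x) X + d)"
  shows "(\<Sum>i\<in>I. measure_pmf.prob (bind_pmf p (f i)) X)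
    \<le> c * (measure_pmf.prob (bind_pmf p g) X + d)"
proof -
  have int: "integrable (measure_pmf p) (\<lambda>x. measure_pmf.prob (h x) X)" for h :: "'a \<Rightarrow> 'b pmf"
    by (auto intro!: measure_pmf.integrable_const_bound[where B=1])
  have "(\<Sum>i\<in>I. measure_pmf.prob (bind_pmf p (f i)) X) =
      measure_pmf.expectation p (\<lambda>x. \<Sum>i\<in>I. measure_pmf.prob (f i x) X)"
    using int by (simp add: prob_bind_pmf)
  also have "\<dots> \<le> measure_pmf.expectation p (\<lambda>x. c * (measure_pmf.prob (g x) X + d))"
    using int assms by (intro integral_mono_AE) (auto simp: AE_measure_pmf_iff)
  also have "\<dots> = c * (measure_pmf.prob (bind_pmf p g) X + d)"
    using int by (simp add: prob_bind_pmf)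
  finally show ?thesis .
qed

text \<open>Averaged over the hidden matching \<open>M\<close>, each query costs at most \<epsilon>.
  A query reveals at most one edge, so \<open>card F\<close> stays below \<open>B\<close> and a
  known edge is sampled with probability at most \<open>B / k\<close>. A query explores at most two
  vertices, so \<open>card U\<close> stays above \<open>L\<close> and hidden edges are touched with
  probability at most \<open>4 * k / L\<close>.\<close>

lemma sum_prob_run_le_ideal_run:
  fixes n k B L :: nat and R :: "real set"
  assumes "finite U" "finite F" "\<Union>F \<inter> U = {}" "card F + j = k" "k > 0"
    and "card F + b \<le> B" "L + 2 * b \<le> card U"
    and "real B \<le> \<epsilon> * real k" "4 * real k \<le> \<epsilon> * real L" "\<epsilon> \<ge> 0"
  shows "(\<Sum>M\<in>matchings U j. measure_pmf.prob (run n (F \<union> M) T) (R \<times> {..b}))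
     \<le> real (card (matchings U j)) *
        (measure_pmf.prob (ideal_run n T U F) (R \<times> {..b}) + real b * \<epsilon>)"
  using assms(1-7)
proof (induction T arbitrary: U F j b)
  case (Output r)
  then show ?case using assms(10) by (simp add: distrib_left)
next
  case (Choose p)
  show ?case
    unfolding run_Choose ideal_run_Choose
    using Choose.IH[OF _ Choose.prems] by (intro sum_prob_bind_le)
next
  case (Ask z h)
  show ?case
  proof (cases b)
    \<comment> \<open>A run that begins with a query makes at least one, so the event is impossible
      without budget.\<close>
    case 0
    then show ?thesis unfolding run_Ask ideal_run.simps
      by (simp only: prob_tick_0) simp
  next
    case (Suc b')
    let ?X = "R \<times> {..b'}"
    show ?thesis
    proof (cases "z = RandEdge")
      case False
      define D where "D = arguments z \<inter> U"
      let ?bad = "{M \<in> matchings U j. \<Union>M \<inter> D \<noteq> {}}"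
      let ?W = "measure_pmf.prob (bind_pmf (reply n F z) (\<lambda>a. ideal_run n (h a) (U - D) F)) ?X"
      have fin: "finite (matchings U j)" using Ask.prems finite_matchings by blast
      have UD: "U - arguments z = U - D" by (auto simp: D_def)
      have D2: "card D \<le> 2"
        using card_arguments[of z] card_mono[of "arguments z" D] by (auto simp: D_def)
      have cardUD: "L + 2 * b' \<le> card (U - D)"
        using D2 diff_card_le_card_Diff[of D U] card_arguments[of z] Ask.prems(7) Suc
        by (auto simp: D_def)
      \<comment> \<open>Matchings of \<open>U\<close> that avoid \<open>D\<close> are exactly the
        matchings of \<open>U - D\<close>, so the induction hypothesis applies to them.\<close>
      have split: "matchings U j = matchings (U - D) j \<union> ?bad" "matchings (U - D) j \<inter> ?bad = {}"
        by (auto simp: matchings_def vertex_pairs_def)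
      have sub: "matchings (U - D) j \<subseteq> matchings U j" using split(1) by blast
      have bad: "real (card ?bad) \<le> real (card (matchings U j)) * \<epsilon>"
      proof -
        have "card U * card ?bad \<le> 2 * j * card D * card (matchings U j)"
          using Ask.prems by (intro card_matchings_touching) (auto simp: D_def)
        also have "\<dots> \<le> 4 * k * card (matchings U j)"
        proof -
          have "j * card D \<le> k * 2" using D2 Ask.prems(4) by (intro mult_mono) auto
          then show ?thesis by simp
        qed
        finally have "real (card U * card ?bad) \<le> real (4 * k * card (matchings U j))"
          by (simp only: of_nat_le_iff)
        then have "real (card U) * real (card ?bad) \<le> 4 * real k * real (card (matchings U j))"
          by simp
        also have "\<dots> \<le> (\<epsilon> * real (card U)) * real (card (matchings U j))"
        proof (rule mult_right_mono)
          have "\<epsilon> * real L \<le> \<epsilon> * real (card U)"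
            using assms(10) Ask.prems(7) by (intro mult_left_mono) auto
          then show "4 * real k \<le> \<epsilon> * real (card U)" using assms(9) by simp
        qed simp
        finally have "real (card U) * real (card ?bad)
            \<le> real (card U) * (real (card (matchings U j)) * \<epsilon>)"
          by (simp add: mult_ac)
        moreover have "card U > 0" using Ask.prems(7) Suc by simp
        ultimately show ?thesis by simp
      qed
      let ?Q = "\<lambda>M. measure_pmf.prob
        (bind_pmf (reply n (F \<union> M) z) (\<lambda>a. run n (F \<union> M) (h a))) ?X"
      have untouched: "(\<Sum>M\<in>matchings (U - D) j. ?Q M)
          \<le> real (card (matchings U j)) * (?W + real b' * \<epsilon>)"
      proof -
        have "(\<Sum>M\<in>matchings (U - D) j. ?Q M) = (\<Sum>M\<in>matchings (U - D) j. measure_pmf.prob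
            (bind_pmf (reply n F z) (\<lambda>a. run n (F \<union> M) (h a))) ?X)"
        proof (rule sum.cong)
          fix M assume "M \<in> matchings (U - D) j"
          then have "\<Union>M \<inter> arguments z = {}"
            using Union_matching_subset[of M "U - D" j] by (auto simp: D_def)
          then show "?Q M = measure_pmf.prob (bind_pmf (reply n F z) (\<lambda>a. run n (F \<union> M) (h a))) ?X"
            using reply_unexplored[OF False] by simp
        qed simp
        also have "\<dots> \<le> real (card (matchings (U - D) j)) * (?W + real b' * \<epsilon>)"
        proof (intro sum_prob_bind_le Ask.IH)
          show "finite (U - D)" "\<Union>F \<inter> (U - D) = {}" "card F + b' \<le> B"
            using Ask.prems Suc by auto
        qed (use Ask.prems cardUD in auto)
        also have "\<dots> \<le> real (card (matchings U j)) * (?W + real b' * \<epsilon>)"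
          using card_mono[OF fin sub] assms(10)
          by (intro mult_right_mono of_nat_mono add_nonneg_nonneg) auto
        finally show ?thesis .
      qed
      have "(\<Sum>M\<in>matchings U j. measure_pmf.prob (run n (F \<union> M) (Ask z h)) (R \<times> {..b})) =
            (\<Sum>M\<in>matchings U j. ?Q M)"
        unfolding run_Ask Suc by (simp only: prob_tick_Suc)
      also have "\<dots> = (\<Sum>M\<in>matchings (U - D) j. ?Q M) + (\<Sum>M\<in>?bad. ?Q M)"
        using sum.union_disjoint[OF finite_subset[OF sub fin] _ split(2), of ?Q] fin
        unfolding split(1)[symmetric] by simp
      also have "\<dots> \<le> real (card (matchings U j)) * (?W + real b' * \<epsilon>) +
          real (card (matchings U j)) * \<epsilon>"
      proof (rule add_mono[OF untouched])
        \<comment> \<open>On the bad matchings every probability is bounded by 1; their share is at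
          most \<epsilon>.\<close>
        have "(\<Sum>M\<in>?bad. ?Q M) \<le> (\<Sum>M\<in>?bad. 1)" by (intro sum_mono) simp
        then have "(\<Sum>M\<in>?bad. ?Q M) \<le> real (card ?bad)" by (simp only: sum_constant mult_1_right)
        with bad show "(\<Sum>M\<in>?bad. ?Q M) \<le> real (card (matchings U j)) * \<epsilon>"
          by (rule order_trans[rotated])
      qed
      also have "\<dots> = real (card (matchings U j)) * (?W + real b * \<epsilon>)"
        by (simp add: Suc algebra_simps)
      also have "?W = measure_pmf.prob (ideal_run n (Ask z h) U F) (R \<times> {..b})"
        unfolding Suc ideal_run.simps using False by (simp only: prob_tick_Suc UD if_False)
      finally show ?thesis .
    next
      case True
      let ?V = "\<lambda>e G. measure_pmf.prob (run n G (h (AEdge e))) ?X"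
      let ?W = "\<lambda>e. measure_pmf.prob (ideal_run n (h (AEdge e)) (U - e) (insert e F)) ?X"
      let ?P = "vertex_pairs U"
      define w where "w = measure_pmf.prob (ideal_run n (Ask z h) U F) (R \<times> {..b})"
      have "0 \<le> w" by (simp add: w_def)
      have finP: "finite ?P" using Ask.prems finite_vertex_pairs by blast
      have "2 \<le> card U" using Ask.prems(7) Suc by simp
      then have "card ?P > 0" using Ask.prems(1) by (simp add: card_vertex_pairs)
      then have "?P \<noteq> {}" by auto
      have w: "w * real (card ?P) = (\<Sum>e\<in>?P. ?W e)"
        unfolding w_def Suc ideal_run.simps using True finP \<open>?P \<noteq> {}\<close>
        by (simp only: prob_tick_Suc prob_bind_pmf if_True refl) (simp add: integral_pmf_of_set)
      \<comment> \<open>\<open>F \<union> M\<close> always has \<open>k\<close> edges, so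
        \<open>RandEdge\<close> averages over the known and the hidden edges with weight
        \<open>1 / k\<close> each.\<close>
      have FM: "real k * measure_pmf.prob (run n (F \<union> M) (Ask z h)) (R \<times> {..b}) =
          (\<Sum>e\<in>F. ?V e (F \<union> M)) + (\<Sum>e\<in>M. ?V e (F \<union> M))" if M: "M \<in> matchings U j" for M
      proof -
        have finM: "finite M" using M Ask.prems finite_matching by blast
        \<comment> \<open>A common edge would lie in \<open>U\<close> and also avoid
          \<open>U\<close>, hence be empty.\<close>
        have disj: "F \<inter> M = {}"
          using M Ask.prems(3) vertex_pair_nonempty[of _ U] Union_matching_subset[OF M]
          by (fastforce simp: matchings_def)
        have card: "card (F \<union> M) = k"
          using disj finM Ask.prems M by (simp add: card_Un_disjoint matchings_def)
        then have ne: "F \<union> M \<noteq> {}" using \<open>k > 0\<close> by auto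
        have "measure_pmf.prob (run n (F \<union> M) (Ask z h)) (R \<times> {..b}) =
            measure_pmf.prob (bind_pmf (pmf_of_set (F \<union> M)) (\<lambda>e. run n (F \<union> M) (h (AEdge e)))) ?X"
          unfolding run_Ask Suc True using ne
          by (simp only: prob_tick_Suc reply.simps if_False bind_map_pmf)
        also have "\<dots> = (\<Sum>e\<in>F \<union> M. ?V e (F \<union> M)) / real k"
          using ne finM Ask.prems(2) card by (simp only: prob_bind_pmf) (simp add: integral_pmf_of_set)
        also have "\<dots> = ((\<Sum>e\<in>F. ?V e (F \<union> M)) + (\<Sum>e\<in>M. ?V e (F \<union> M))) / real k"
          using disj finM Ask.prems(2) by (simp add: sum.union_disjoint)
        finally show ?thesis using \<open>k > 0\<close> by simp
      qed
      have old: "(\<Sum>M\<in>matchings U j. \<Sum>e\<in>F. ?V e (F \<union> M))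
          \<le> real k * (real (card (matchings U j)) * \<epsilon>)"
      proof -
        have "(\<Sum>M\<in>matchings U j. \<Sum>e\<in>F. ?V e (F \<union> M)) \<le> (\<Sum>M\<in>matchings U j. \<Sum>e\<in>F. 1)"
          by (intro sum_mono) simp
        also have "\<dots> = real (card (matchings U j)) * real (card F)" by simp
        also have "\<dots> \<le> real (card (matchings U j)) * (\<epsilon> * real k)"
          using Ask.prems(6) assms(8) by (intro mult_left_mono) auto
        finally show ?thesis by (simp add: mult_ac)
      qed
      have new: "(\<Sum>M\<in>matchings U j. \<Sum>e\<in>M. ?V e (F \<union> M))
          \<le> real k * (real (card (matchings U j)) * (w + real b' * \<epsilon>))"
      proof (cases j)
        case 0
        then show ?thesis using Ask.prems(1) \<open>0 \<le> w\<close> assms(10)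
          by (simp add: matchings_0)
      next
        case (Suc i)
        obtain f where f: "f \<in> ?P" using \<open>?P \<noteq> {}\<close> by auto
        let ?c = "real (card (matchings (U - f) i))"
        \<comment> \<open>This turns pairs with completions back into hidden edges of matchings, so
          that the factor \<open>j \<le> k\<close> appears below.\<close>
        have cnt: "real j * real (card (matchings U j)) = real (card ?P) * ?c"
          using card_matchings_Suc[OF Ask.prems(1) f, of i] Ask.prems(1)
          unfolding Suc by (metis card_vertex_pairs of_nat_mult)
        have "(\<Sum>M\<in>matchings U j. \<Sum>e\<in>M. ?V e (F \<union> M)) =
            (\<Sum>e\<in>?P. \<Sum>M\<in>matchings (U - e) i. ?V e (insert e F \<union> M))"
          unfolding Suc using Ask.prems(1) by (subst sum_matchings_edges) auto
        also have "\<dots> \<le> (\<Sum>e\<in>?P. ?c * (?W e + real b' * \<epsilon>))"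
        proof (rule sum_mono)
          fix e assume e: "e \<in> ?P"
          then have eU: "e \<subseteq> U" "card e = 2" "e \<noteq> {}" by (auto simp: vertex_pairs_def)
          have "e \<notin> F" using eU Ask.prems(3) by auto
          moreover have "card (U - e) = card U - 2"
            using eU Ask.prems(1) by (simp add: card_Diff_subset finite_subset)
          \<comment> \<open>Revealing \<open>e\<close> moves one edge from hidden to known, removes
            two vertices from \<open>U\<close> and spends one query, which preserves all
            invariants.\<close>
          ultimately have "(\<Sum>M\<in>matchings (U - e) i. ?V e (insert e F \<union> M))
              \<le> real (card (matchings (U - e) i)) * (?W e + real b' * \<epsilon>)"
            using Ask.prems \<open>b = Suc b'\<close> Suc
            by (intro Ask.IH) auto
          then show "(\<Sum>M\<in>matchings (U - e) i. ?V e (insert e F \<union> M)) \<le> ?c * (?W e + real b' * \<epsilon>)"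
            using card_matchings_remove_pair[OF Ask.prems(1) e f, of i] by simp
        qed
        also have "\<dots> = ?c * ((\<Sum>e\<in>?P. ?W e) + real (card ?P) * (real b' * \<epsilon>))"
          by (simp add: sum.distrib flip: sum_distrib_left)
        also have "\<dots> = (real (card ?P) * ?c) * (w + real b' * \<epsilon>)"
          by (simp add: w[symmetric] algebra_simps)
        also have "\<dots> = real j * (real (card (matchings U j)) * (w + real b' * \<epsilon>))"
          by (simp add: cnt[symmetric])
        also have "\<dots> \<le> real k * (real (card (matchings U j)) * (w + real b' * \<epsilon>))"
          using Ask.prems(4) \<open>0 \<le> w\<close> assms(10) by (intro mult_right_mono) auto
        finally show ?thesis .
      qed
      have "real k * (\<Sum>M\<in>matchings U j. measure_pmf.prob (run n (F \<union> M) (Ask z h)) (R \<times> {..b})) =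
          (\<Sum>M\<in>matchings U j. \<Sum>e\<in>F. ?V e (F \<union> M)) + (\<Sum>M\<in>matchings U j. \<Sum>e\<in>M. ?V e (F \<union> M))"
        unfolding sum_distrib_left sum.distrib[symmetric] by (intro sum.cong refl FM)
      also have "\<dots> \<le> real k * (real (card (matchings U j)) * (w + real b * \<epsilon>))"
        using add_mono[OF old new] by (simp add: Suc algebra_simps)
      finally show ?thesis using \<open>k > 0\<close> by (simp add: w_def)
    qed
  qed
qed

section \<open>The lower bound\<close>

text \<open>Every matching with \<open>j\<close> edges has average degree \<open>a\<close>, so the
  guarantee of the algorithm survives averaging and passes to the ideal run up to the total error.
  The ideal run itself is the same for every \<open>j\<close>.\<close>

lemma ideal_run_accuracy:
  assumes "approximates_avg_degree c A" "query_bound A q"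
    and "j > 0" "2 * j \<le> n" "L + 2 * q n \<le> n"
    and "real (q n) \<le> \<epsilon> * real j" "4 * real j \<le> \<epsilon> * real L" "\<epsilon> \<ge> 0"
  defines "a \<equiv> 2 * real j / real n"
  shows "2 / 3 - real (q n) * \<epsilon>
    \<le> measure_pmf.prob (ideal_run n (A n) {..<n} {}) ({a / c .. c * a} \<times> {..q n})"
proof -
  let ?Ms = "matchings {..<n} j" and ?X = "{a / c .. c * a} \<times> {..q n}"
  have n: "n \<ge> 1" using assms by simp
  have "2 / 3 \<le> measure_pmf.prob (run n M (A n)) ?X" if M: "M \<in> ?Ms" for M
  proof -
    have G: "simple_graph n M"
      using M by (auto simp: matchings_def vertex_pairs_def simple_graph_def)
    have "avg_degree n M = a"
      using M by (simp add: a_def avg_degree_def matchings_def)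
    then have "2 / 3 < measure_pmf.prob (run n M (A n)) {(r, t). r \<in> {a / c .. c * a}}"
      using assms(1) n G by (auto simp: approximates_avg_degree_def)
    \<comment> \<open>The query bound holds almost surely, so restricting to at most
      \<open>q n\<close> queries loses no probability.\<close>
    also have "\<dots> \<le> measure_pmf.prob (run n M (A n)) ?X"
      using assms(2) n G
      by (intro measure_pmf.finite_measure_mono_AE)
        (fastforce simp: AE_measure_pmf_iff query_bound_def)+
    finally show ?thesis by simp
  qed
  then have "real (card ?Ms) * (2 / 3) \<le> (\<Sum>M\<in>?Ms. measure_pmf.prob (run n ({} \<union> M) (A n)) ?X)"
    using sum_mono[of ?Ms "\<lambda>_. 2 / 3 :: real"] by (simp only: sum_constant Un_empty_left)
  also have "\<dots> \<le> real (card ?Ms) *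
      (measure_pmf.prob (ideal_run n (A n) {..<n} {}) ?X + real (q n) * \<epsilon>)"
    using assms by (intro sum_prob_run_le_ideal_run[where B="q n" and L=L and k=j]) auto
  finally have "real (card ?Ms) * (2 / 3) \<le> real (card ?Ms) *
      (measure_pmf.prob (ideal_run n (A n) {..<n} {}) ?X + real (q n) * \<epsilon>)" .
  moreover have "card ?Ms > 0"
    using matchings_nonempty[of "{..<n}" j] assms(4) by (simp add: finite_matchings card_gt_0_iff)
  ultimately show ?thesis by (simp add: mult_le_cancel_left)
qed

text \<open>The ideal run would have to be accurate for \<open>k\<close> and for
  \<open>C * k\<close> edges at once. The two target intervals are disjoint, so twice
  \<open>2 / 3 - real (q n) * \<epsilon>\<close> is at most 1.\<close>

lemma query_error_lower_bound:
  fixes C k n L :: nat and \<epsilon> :: real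
  assumes "c \<ge> 1" "approximates_avg_degree c A" "query_bound A q"
    and "c * c < real C" "k > 0" "2 * (C * k) \<le> n" "L + 2 * q n \<le> n"
    and "real (q n) \<le> \<epsilon> * real k" "4 * real (C * k) \<le> \<epsilon> * real L" "\<epsilon> \<ge> 0"
  shows "1 / 6 \<le> real (q n) * \<epsilon>"
proof -
  define a where "a = (\<lambda>j::nat. 2 * real j / real n)"
  define R where "R = (\<lambda>j. {a j / c .. c * a j})"
  let ?p = "ideal_run n (A n) {..<n} {}"
  have "1 \<le> c * c" using assms(1) mult_mono[of 1 c 1 c] by simp
  then have C: "C \<ge> 1" using assms(4) by linarith
  then have kC: "k \<le> C * k" by simp
  have "n > 0" using assms(5,6) C by (cases n) auto
  then have "a k > 0" using assms(5) by (simp add: a_def)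
  have "c * c * a k < C * a k" using assms(4) \<open>a k > 0\<close> by simp
  also have "C * a k = a (C * k)" by (simp add: a_def)
  \<comment> \<open>The upper end of the first interval lies below the lower end of the
    second.\<close>
  finally have "c * a k < a (C * k) / c"
    using assms(1) by (simp add: pos_less_divide_eq mult_ac)
  then have "R k \<inter> R (C * k) = {}" by (auto simp: R_def)
  then have disj: "(R k \<times> {..q n}) \<inter> (R (C * k) \<times> {..q n}) = {}" by auto
  have "2 / 3 - real (q n) * \<epsilon> \<le> measure_pmf.prob ?p (R k \<times> {..q n})"
  proof -
    have *: "4 * real k \<le> \<epsilon> * real L"
      using assms(9) kC by (meson mult_left_mono of_nat_mono order_trans zero_le_numeral)
    have "2 * k \<le> n" using assms(6) kC by linarith
    then show ?thesis
      unfolding R_def a_def using assms * by (intro ideal_run_accuracy[where L=L])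
  qed
  moreover have "2 / 3 - real (q n) * \<epsilon> \<le> measure_pmf.prob ?p (R (C * k) \<times> {..q n})"
  proof -
    have "\<epsilon> * real k \<le> \<epsilon> * real (C * k)"
      using kC assms(10) by (intro mult_left_mono of_nat_mono)
    then have "real (q n) \<le> \<epsilon> * real (C * k)" using assms(8) by linarith
    then show ?thesis
      unfolding R_def a_def using assms kC by (intro ideal_run_accuracy[where L=L]) auto
  qed
  moreover have "measure_pmf.prob ?p (R k \<times> {..q n}) + measure_pmf.prob ?p (R (C * k) \<times> {..q n}) \<le> 1"
    using measure_pmf.finite_measure_Union[OF _ _ disj, of ?p]
      measure_pmf.prob_le_1[of ?p "(R k \<times> {..q n}) \<union> (R (C * k) \<times> {..q n})"] by simp
  ultimately show ?thesis by simp
qed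

section \<open>Choice of the parameters\<close>

text \<open>With \<open>x\<close> the cube root of \<open>n\<close>, taking \<open>k\<close> near
  the square of \<open>x\<close> balances the errors: for at most \<open>x\<close> queries, both
  \<open>q n / k\<close> and \<open>k / n\<close> are of order \<open>1 / x\<close>.\<close>

lemma queries_lower_bound_cube_root:
  fixes C n :: nat
  assumes "c \<ge> 1" "approximates_avg_degree c A" "query_bound A q"
    and "c * c < real C" "(4 * C) ^ 3 \<le> n"
  shows "1 / (100 * real C) * real n powr (1 / 3) \<le> real (q n)"
proof (rule ccontr)
  define x where "x = real n powr (1 / 3)"
  define k where "k = nat \<lceil>x\<^sup>2\<rceil>"
  define L where "L = n - 2 * q n"
  have "1 \<le> c * c" using assms(1) mult_mono[of 1 c 1 c] by simp
  then have C: "real C > 1" "C \<ge> 1" using assms(4) by linarith+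
  have "(4 * C) ^ 3 > 0" using C by simp
  then have "n > 0" using assms(5) by linarith
  then have x3: "x ^ 3 = real n" by (simp add: x_def powr_power)
  have "x > 0" using \<open>n > 0\<close> by (simp add: x_def)
  have "(4 * real C) ^ 3 \<le> x ^ 3"
    unfolding x3 using of_nat_mono[OF assms(5), where 'a=real] by simp
  moreover have "(4 * real C) ^ 3 \<le> x ^ 3 \<longleftrightarrow> 4 * real C \<le> x"
    using \<open>x > 0\<close> by (intro power_mono_iff) auto
  ultimately have x: "4 * real C \<le> x" by blast
  have "x \<ge> 1" using x C by linarith
  then have "x\<^sup>2 \<ge> 1" by simp
  have k: "x\<^sup>2 \<le> real k" "real k \<le> 2 * x\<^sup>2"
    using \<open>x\<^sup>2 \<ge> 1\<close> unfolding k_def by linarith+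
  have "k > 0" using k(1) \<open>x\<^sup>2 \<ge> 1\<close> by (intro Suc_leI gr0I) auto
  assume "\<not> ?thesis"
  then have q: "real (q n) < x / (100 * real C)" by (simp add: x_def)
  also have "\<dots> \<le> x / 100"
    using C \<open>x > 0\<close> by (intro divide_left_mono) auto
  finally have q1: "real (q n) < x / 100" .
  have "x \<le> x ^ 3" using \<open>x \<ge> 1\<close> self_le_power[of x 3] by simp
  then have q2: "4 * real (q n) \<le> real n" using q1 \<open>x > 0\<close> x3 by linarith
  then have "2 * q n \<le> n" by linarith
  then have L: "L + 2 * q n = n" by (simp add: L_def)
  then have "real L + 2 * real (q n) = real n" by (metis of_nat_add of_nat_mult of_nat_numeral)
  then have Lx: "real L \<ge> x ^ 3 / 2" using q2 x3 by linarith
  \<comment> \<open>Here \<open>4 * C * k\<close> is at most 8 C times the square of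
    \<open>x\<close>, and \<open>L\<close> is at least half the cube of \<open>x\<close>; the
    quotient of these bounds is this value.\<close>
  define \<epsilon> where "\<epsilon> = 16 * real C / x"
  have "1 / 6 \<le> real (q n) * \<epsilon>"
  proof (rule query_error_lower_bound[OF assms(1-4) \<open>k > 0\<close>])
    \<comment> \<open>The threshold on \<open>n\<close> enters here: \<open>4 * C \<le> x\<close>
      makes room for the larger matching, even after rounding \<open>k\<close> up.\<close>
    have "2 * (real C * real k) \<le> 2 * (real C * (2 * x\<^sup>2))"
      using k by (intro mult_left_mono) auto
    also have "\<dots> = (4 * real C) * x\<^sup>2" by simp
    also have "\<dots> \<le> x * x\<^sup>2" using x by (intro mult_right_mono) auto
    also have "\<dots> = real n" using x3 by (simp add: power3_eq_cube power2_eq_square)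
    finally have "real (2 * (C * k)) \<le> real n" by simp
    then show "2 * (C * k) \<le> n" by (simp only: of_nat_le_iff)
    show "L + 2 * q n \<le> n" using L by simp
    show "\<epsilon> \<ge> 0" using \<open>x > 0\<close> by (simp add: \<epsilon>_def)
    have "real (q n) \<le> x" using q1 \<open>x > 0\<close> by linarith
    also have "x \<le> 16 * real C * x" using C \<open>x > 0\<close> by simp
    also have "\<dots> = \<epsilon> * x\<^sup>2" using \<open>x > 0\<close> by (simp add: \<epsilon>_def power2_eq_square)
    also have "\<dots> \<le> \<epsilon> * real k" using k \<open>\<epsilon> \<ge> 0\<close> by (intro mult_left_mono)
    finally show "real (q n) \<le> \<epsilon> * real k" .
    have "4 * real (C * k) \<le> 4 * (real C * (2 * x\<^sup>2))"
      unfolding of_nat_mult using k by (intro mult_left_mono) auto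
    also have "\<dots> = \<epsilon> * (x ^ 3 / 2)"
      using \<open>x > 0\<close> by (simp add: \<epsilon>_def power3_eq_cube power2_eq_square)
    also have "\<dots> \<le> \<epsilon> * real L" using Lx \<open>\<epsilon> \<ge> 0\<close> by (intro mult_left_mono)
    finally show "4 * real (C * k) \<le> \<epsilon> * real L" .
  qed
  also have "real (q n) * \<epsilon> \<le> (x / (100 * real C)) * \<epsilon>"
    using q \<open>x > 0\<close> by (intro mult_right_mono) (auto simp: \<epsilon>_def)
  \<comment> \<open>The constant 100 is chosen so that this falls below
    \<open>1 / 6\<close>.\<close>
  also have "\<dots> = 16 / 100" using \<open>x > 0\<close> C by (simp add: \<epsilon>_def)
  finally show False by simp
qed

theorem theorem5p1:
  fixes A :: "nat \<Rightarrow> algorithm" and c :: real and q :: "nat \<Rightarrow> nat"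
  assumes "c \<ge> 1"
    and "approximates_avg_degree c A"
    and "query_bound A q"
  shows "(has_access basic_queries A \<longrightarrow>
            (\<lambda>n. real (q n)) \<in> \<Omega>(\<lambda>n. real n powr (1 / 3)))
       \<and> (has_access (basic_queries \<union> pair_queries) A \<longrightarrow>
            (\<lambda>n. real (q n)) \<in> \<Omega>(\<lambda>n. real n powr (1 / 4)))
       \<and> (has_access (basic_queries \<union> full_nbr_hood_queries) A \<longrightarrow>
            (\<lambda>n. real (q n)) \<in> \<Omega>(\<lambda>n. real n powr (1 / 5)))"
proof -
  obtain C :: nat where C: "c * c < real C" using reals_Archimedean2 by blast
  moreover have "0 \<le> c * c" by simp
  ultimately have "real C > 0" by linarith
  \<comment> \<open>Once \<open>n \<ge> 1\<close>, \<open>n powr p\<close> is at most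
    \<open>n powr (1 / 3)\<close>, so the cube root bound yields the exponents \<open>1 / 3\<close>,
    \<open>1 / 4\<close> and \<open>1 / 5\<close> together.\<close>
  have "(\<lambda>n. real (q n)) \<in> \<Omega>(\<lambda>n. real n powr p)" if "p \<le> 1 / 3" for p
  proof (rule landau_omega.bigI)
    show "1 / (100 * real C) > 0" using \<open>real C > 0\<close> by simp
    show "\<forall>\<^sub>F n in sequentially.
        1 / (100 * real C) * norm (real n powr p) \<le> norm (real (q n))"
      using eventually_ge_at_top[of "(4 * C) ^ 3"] eventually_ge_at_top[of 1]
    proof eventually_elim
      case (elim n)
      have "1 / (100 * real C) * real n powr p \<le> 1 / (100 * real C) * real n powr (1 / 3)"
        using elim that by (intro mult_left_mono powr_mono) auto
      also have "\<dots> \<le> real (q n)"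
        using queries_lower_bound_cube_root[OF assms C elim(1)] .
      finally show ?case by simp
    qed
  qed
  then show ?thesis by simp
qed

end
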